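(* Let $(X,d)$ be a starry metric space and let $\phi\colon (X,d)\to(\phi(X),d_\phi)$ be a quasisymmetric mapping onto a metric space $(\phi(X),d_\phi)$. Then $\dim_{\mathrm A}\phi(X)=\infty$.
   Context: **Approximate stars.** Let $A>1$ and $0<\eta<1$ satisfy $A-\eta>1+\eta$ (equivalently $\eta<(A-1)/2$). A metric space $(X,d)$ contains an $(A,\eta)$-approximate $n$-star if there exist $\varrho>0$ and points $x_0,\dots,x_n\in X$ such that $(A-\eta)\varrho\le d(x_i,x_j)\le A\varrho$ for all $i,j\in\{1,\dots,n\}$ with $i\ne j$, and $\varrho\le d(x_0,x_i)\le(1+\eta)\varrho$ for all $i\in\{1,\dots,n\}$. **Starry.** $(X,d)$ is starry if there exist $A>1$ and $0<\eta<(A-1)/2$ (independent of $n$) such that for every $n\in\mathbb N$ there is $A_n\ge A$ for which $(X,d)$ contains an $(A_n,\eta)$-approximate $n$-star. **Quasisymmetric.** A homeomorphism $\phi\colon X\to Y$ between metric spaces $(X,d_X)$, $(Y,d_Y)$ is quasisymmetric if there is an increasing function $\Psi\colon(0,\infty)\to(0,\infty)$ such that for any three distinct points $x,y,z\in X$, $$\frac{d_Y(\phi(x),\phi(y))}{d_Y(\phi(x),\phi(z))}\le\Psi\left(\frac{d_X(x,y)}{d_X(x,z)}\right).$$ **Assouad dimension.** For a metric space $X$, $N(E,r)$ is the minimal number of sets of diameter at most $r$ needed to cover $E\subseteq X$ ($N(E,r)=\infty$ if there is no finite cover), $B(x,R)$ is the closed ball, and $$\dim_{\mathrm A}(X)=\inf\Big\{\alpha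 : (\exists C>0)(\forall\, 0<r<R)\ \sup_{x\in X}N(B(x,R),r)\le C\Big(\frac Rr\Big)^\alpha\Big\},$$ with $\inf\varnothing=\infty$. *)

theory Defs
  imports "HOL-Analysis.Analysis"
begin

definition approximate_star :: "'a metric \<Rightarrow> real \<Rightarrow> real \<Rightarrow> nat \<Rightarrow> bool" where
  "approximate_star X A \<eta> n \<longleftrightarrow>
     1 < A \<and> 0 < \<eta> \<and> \<eta> < 1 \<and> 1 + \<eta> < A - \<eta> \<and>
     (\<exists>\<rho>>0. \<exists>x :: nat \<Rightarrow> 'a.
        (\<forall>i\<in>{0..n}. x i \<in> mspace X) \<and>
        (\<forall>i\<in>{1..n}. \<forall>j\<in>{1..n}. i \<noteq> j \<longrightarrow>
           (A - \<eta>) * \<rho> \<le> mdist X (x i) (x j) \<and> mdist X (x i) (x j) \<le> A * \<rho>) \<and>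
        (\<forall>i\<in>{1..n}. \<rho> \<le> mdist X (x 0) (x i) \<and> mdist X (x 0) (x i) \<le> (1 + \<eta>) * \<rho>))"

definition starry :: "'a metric \<Rightarrow> bool" where
  "starry X \<longleftrightarrow>
     (\<exists>A>1. \<exists>\<eta>>0. \<eta> < (A - 1) / 2 \<and> (\<forall>n. \<exists>A'\<ge>A. approximate_star X A' \<eta> n))"

text \<open>The control function is only required to be nondecreasing; its values outside the
  positive half-line are irrelevant.\<close>

definition quasisymmetric :: "'a metric \<Rightarrow> 'b metric \<Rightarrow> ('a \<Rightarrow> 'b) \<Rightarrow> bool" where
  "quasisymmetric X Y \<phi> \<longleftrightarrow>
     homeomorphic_map (mtopology_of X) (mtopology_of Y) \<phi> \<and>
     (\<exists>\<Psi> :: real \<Rightarrow> real. \<Psi> \<in> {0<..} \<rightarrow> {0<..} \<and> mono_on {0<..} \<Psi> \<and>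
        (\<forall>x\<in>mspace X. \<forall>y\<in>mspace X. \<forall>z\<in>mspace X. x \<noteq> y \<and> x \<noteq> z \<and> y \<noteq> z \<longrightarrow>
           mdist Y (\<phi> x) (\<phi> y) / mdist Y (\<phi> x) (\<phi> z) \<le> \<Psi> (mdist X x y / mdist X x z)))"

text \<open>Having diameter at most \<open>r\<close> is written out pointwise, which avoids the supremum of
  an unbounded set of reals. Without a finite cover the infimum in \<^typ>\<open>enat\<close> is
  infinite.\<close>

definition covering_number :: "'a metric \<Rightarrow> 'a set \<Rightarrow> real \<Rightarrow> enat" where
  "covering_number X E r =
     Inf {enat (card \<U>) | \<U>. finite \<U> \<and> E \<subseteq> \<Union>\<U> \<and>
            (\<forall>U\<in>\<U>. U \<subseteq> mspace X \<and> (\<forall>x\<in>U. \<forall>y\<in>U. mdist X x y \<le> r))}"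

definition assouad_dim :: "'a metric \<Rightarrow> ereal" where
  "assouad_dim X =
     Inf {ereal \<alpha> | \<alpha>. \<exists>C>0. \<forall>r R. 0 < r \<and> r < R \<longrightarrow>
            ereal_of_enat (SUP x\<in>mspace X. covering_number X (mcball_of X x R) r)
              \<le> ereal (C * (R / r) powr \<alpha>)}"

end

theory Submission
  imports Defs
begin

text \<open>
  In a star the \<open>n\<close> tips lie at comparable distances from the centre and are separated by
  more than these distances. A quasisymmetric map distorts ratios of distances by a bounded
  amount, so the image contains, for every \<open>n\<close>, a ball of some radius \<open>R\<close> with \<open>n\<close> points that
  are pairwise more than \<open>c R\<close> apart, where \<open>c > 0\<close> does not depend on \<open>n\<close>. Thus the covering
  numbers at the fixed scale ratio \<open>c\<close> are unbounded, which no finite exponent permits.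
\<close>

text \<open>A set of diameter at most \<open>r\<close> contains at most one point of
  \<open>S\<close>, so sending each point of \<open>S\<close> to a member of the cover containing it
  is injective.\<close>

lemma card_le_covering_number:
  assumes "S \<subseteq> E" and sep: "pairwise (\<lambda>p q. r < mdist X p q) S"
  shows "enat (card S) \<le> covering_number X E r"
  unfolding covering_number_def
proof (rule Inf_greatest)
  fix k
  assume "k \<in> {enat (card \<U>) | \<U>. finite \<U> \<and> E \<subseteq> \<Union>\<U> \<and>
            (\<forall>U\<in>\<U>. U \<subseteq> mspace X \<and> (\<forall>x\<in>U. \<forall>y\<in>U. mdist X x y \<le> r))}"
  then obtain \<U> where k: "k = enat (card \<U>)" and "finite \<U>" and cover: "E \<subseteq> \<Union>\<U>"
    and \<U>: "\<forall>U\<in>\<U>. U \<subseteq> mspace X \<and> (\<forall>x\<in>U. \<forall>y\<in>U. mdist X x y \<le> r)"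
    unfolding mem_Collect_eq by (elim exE conjE)
  have diam: "mdist X x y \<le> r" if "U \<in> \<U>" "x \<in> U" "y \<in> U" for U x y
    using \<U> that by simp
  have "\<forall>p\<in>S. \<exists>U\<in>\<U>. p \<in> U"
    using cover \<open>S \<subseteq> E\<close> by blast
  then obtain f where f: "\<And>p. p \<in> S \<Longrightarrow> f p \<in> \<U> \<and> p \<in> f p"
    by (auto simp: bchoice_iff Bex_def)
  have "inj_on f S"
  proof (rule inj_onI, rule ccontr)
    fix p q assume pq: "p \<in> S" "q \<in> S" "f p = f q" "p \<noteq> q"
    then have "p \<in> f p" "q \<in> f p" "f p \<in> \<U>"
      using f[of p] f[of q] by simp_all
    then have "mdist X p q \<le> r"
      by (intro diam)
    moreover have "r < mdist X p q"
      using sep pq by (simp add: pairwise_def)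
    ultimately show False by simp
  qed
  then have "card S \<le> card \<U>"
    using f \<open>finite \<U>\<close> by (intro card_inj_on_le[of f]) auto
  then show "enat (card S) \<le> k"
    by (simp add: k)
qed

text \<open>With \<open>r = c * R\<close> the bound \<open>C * (R / r) powr \<alpha>\<close> equals
  a constant, whatever \<open>R\<close> is. The radius may therefore vary with \<open>n\<close>;
  only the ratio \<open>c\<close> must be uniform. No real exponent is admissible, and the infimum
  of the empty set is \<infinity>.\<close>

lemma assouad_dim_eq_infinity:
  assumes c: "0 < c" "c < 1"
    and ex: "\<And>n. \<exists>a\<in>mspace Y. \<exists>R>0. \<exists>S \<subseteq> mcball_of Y a R.
               card S = n \<and> pairwise (\<lambda>p q. c * R < mdist Y p q) S"
  shows "assouad_dim Y = \<infinity>"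
proof -
  have False
    if C: "\<And>r R. 0 < r \<Longrightarrow> r < R \<Longrightarrow>
            ereal_of_enat (SUP x\<in>mspace Y. covering_number Y (mcball_of Y x R) r)
              \<le> ereal (C * (R / r) powr \<alpha>)" for C \<alpha>
  proof -
    define M where "M = C * (1 / c) powr \<alpha>"
    obtain n :: nat where n: "M < real n"
      using reals_Archimedean2 by blast
    obtain a R S where a: "a \<in> mspace Y" and R: "R > 0" and S: "S \<subseteq> mcball_of Y a R"
      "card S = n" "pairwise (\<lambda>p q. c * R < mdist Y p q) S"
      using ex[of n] by blast
    have "enat n \<le> covering_number Y (mcball_of Y a R) (c * R)"
      using card_le_covering_number[OF S(1,3)] S(2) by simp
    also have "\<dots> \<le> (SUP x\<in>mspace Y. covering_number Y (mcball_of Y x R) (c * R))"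
      using a by (rule SUP_upper)
    finally have "ereal_of_enat (enat n)
        \<le> ereal_of_enat (SUP x\<in>mspace Y. covering_number Y (mcball_of Y x R) (c * R))"
      by (simp only: ereal_of_enat_le_iff)
    \<comment> \<open>The assumed bound applies at the scales \<open>c * R\<close> and
      \<open>R\<close> because \<open>0 < c < 1\<close>.\<close>
    also have "\<dots> \<le> ereal (C * (R / (c * R)) powr \<alpha>)"
      using c R by (intro C) simp_all
    also have "R / (c * R) = 1 / c"
      using R by simp
    finally have "real n \<le> M"
      by (simp add: M_def)
    with n show False by simp
  qed
  then have "{ereal \<alpha> | \<alpha>. \<exists>C>0. \<forall>r R. 0 < r \<and> r < R \<longrightarrow>
            ereal_of_enat (SUP x\<in>mspace Y. covering_number Y (mcball_of Y x R) r)
              \<le> ereal (C * (R / r) powr \<alpha>)} = {}"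
    by blast
  then show ?thesis
    by (simp only: assouad_dim_def Inf_empty top_ereal_def)
qed

text \<open>Every ratio of distances that has to be compared in the star is at most 2, so the single
  value \<open>\<Psi> 2\<close> controls the distortion. The separation constant depends on
  \<open>K\<close> alone, so it stays the same when \<open>n\<close> and \<open>A\<close>
  vary.\<close>

lemma quasisymmetric_image_of_star:
  assumes star: "approximate_star X A \<eta> n" and "n \<ge> 1"
    and maps: "\<phi> \<in> mspace X \<rightarrow> mspace Y" and inj: "inj_on \<phi> (mspace X)"
    and mono: "mono_on {0<..} \<Psi>"
    and qs: "\<And>x y z. x \<in> mspace X \<Longrightarrow> y \<in> mspace X \<Longrightarrow> z \<in> mspace X \<Longrightarrow>
        x \<noteq> y \<Longrightarrow> x \<noteq> z \<Longrightarrow> y \<noteq> z \<Longrightarrow>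
        mdist Y (\<phi> x) (\<phi> y) / mdist Y (\<phi> x) (\<phi> z) \<le> \<Psi> (mdist X x y / mdist X x z)"
    and K: "K \<ge> 1" "\<Psi> 2 \<le> K"
  shows "\<exists>a\<in>mspace Y. \<exists>R>0. \<exists>S \<subseteq> mcball_of Y a R.
           card S = n \<and> pairwise (\<lambda>p q. 1 / (2 * K ^ 3) * R < mdist Y p q) S"
proof -
  note mdist_pos = Metric_space.mdist_pos_eq[OF Metric_space_mspace_mdist]
  from star obtain \<rho> x where A: "0 < \<eta>" "\<eta> < 1" "1 + \<eta> < A - \<eta>" and "\<rho> > 0"
    and "\<And>i. i \<in> {0..n} \<Longrightarrow> x i \<in> mspace X"
    and tips: "\<And>i j. i \<in> {1..n} \<Longrightarrow> j \<in> {1..n} \<Longrightarrow> i \<noteq> j \<Longrightarrow> (A - \<eta>) * \<rho> \<le> mdist X (x i) (x j)"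
    and arms: "\<And>i. i \<in> {1..n} \<Longrightarrow> \<rho> \<le> mdist X (x 0) (x i)"
      "\<And>i. i \<in> {1..n} \<Longrightarrow> mdist X (x 0) (x i) \<le> (1 + \<eta>) * \<rho>"
    unfolding approximate_star_def by blast
  then have x: "x i \<in> mspace X" if "i \<le> n" for i
    using that by simp
  define y where "y i = \<phi> (x i)" for i
  have y: "y i \<in> mspace Y" if "i \<le> n" for i
    using x[OF that] maps by (auto simp: y_def)
  have ne0: "x 0 \<noteq> x i" if "i \<in> {1..n}" for i
  proof -
    have "0 < mdist X (x 0) (x i)"
      using arms(1)[OF that] \<open>\<rho> > 0\<close> by linarith
    with that show ?thesis by (simp add: mdist_pos x)
  qed
  \<comment> \<open>Here the gap \<open>1 + \<eta> < A - \<eta>\<close> enters: two tips are farther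
    apart than the length of any arm.\<close>
  have long: "(1 + \<eta>) * \<rho> < mdist X (x i) (x j)" if "i \<in> {1..n}" "j \<in> {1..n}" "i \<noteq> j" for i j
  proof -
    have "(1 + \<eta>) * \<rho> < (A - \<eta>) * \<rho>"
      using A \<open>\<rho> > 0\<close> by simp
    with tips[OF that] show ?thesis by linarith
  qed
  have ne: "x i \<noteq> x j" if "i \<in> {1..n}" "j \<in> {1..n}" "i \<noteq> j" for i j
  proof -
    have "0 < (1 + \<eta>) * \<rho>"
      using A \<open>\<rho> > 0\<close> by simp
    with long[OF that] have "0 < mdist X (x i) (x j)" by linarith
    with that show ?thesis by (simp add: mdist_pos x)
  qed
  have bound: "mdist Y (\<phi> u) (\<phi> v) \<le> K * mdist Y (\<phi> u) (\<phi> w)"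
    if uvw: "u \<in> mspace X" "v \<in> mspace X" "w \<in> mspace X" "u \<noteq> v" "u \<noteq> w" "v \<noteq> w"
      and le: "mdist X u v \<le> 2 * mdist X u w" for u v w
  proof -
    have pos: "0 < mdist X u v" "0 < mdist X u w"
      using uvw by (simp_all add: mdist_pos)
    have "\<phi> u \<noteq> \<phi> w"
      using inj uvw by (auto dest: inj_onD)
    then have pos': "0 < mdist Y (\<phi> u) (\<phi> w)"
      using uvw maps by (auto simp: mdist_pos Pi_iff)
    have "mdist Y (\<phi> u) (\<phi> v) / mdist Y (\<phi> u) (\<phi> w) \<le> \<Psi> (mdist X u v / mdist X u w)"
      using qs uvw by blast
    also have "\<dots> \<le> \<Psi> 2"
      using pos le by (intro mono_onD[OF mono]) (simp_all add: divide_le_eq)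
    also have "\<dots> \<le> K" by (rule K)
    finally show ?thesis
      using pos' by (simp add: divide_le_eq)
  qed
  \<comment> \<open>The first image arm serves as the unit of length, which is why
    \<open>n \<ge> 1\<close> is assumed. All image arms have length at most \<open>K * D\<close>,
    the radius chosen for the ball below.\<close>
  define D where "D = mdist Y (y 0) (y 1)"
  have "x 0 \<noteq> x 1" using ne0 \<open>n \<ge> 1\<close> by simp
  then have "y 0 \<noteq> y 1"
    using inj x \<open>n \<ge> 1\<close> by (auto simp: y_def dest: inj_onD)
  then have "D > 0"
    using y \<open>n \<ge> 1\<close> by (simp add: D_def mdist_pos)
  have arms_le: "mdist X (x 0) (x i) \<le> 2 * mdist X (x 0) (x j)" if "i \<in> {1..n}" "j \<in> {1..n}" for i j
  proof -
    have "(1 + \<eta>) * \<rho> \<le> 2 * \<rho>"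
      using A \<open>\<rho> > 0\<close> by (intro mult_right_mono) auto
    with arms(1)[OF that(2)] arms(2)[OF that(1)] show ?thesis by linarith
  qed
  have arm_compare: "mdist Y (y 0) (y i) \<le> K * mdist Y (y 0) (y j)"
    if "i \<in> {1..n}" "j \<in> {1..n}" for i j
  \<comment> \<open>Quasisymmetry speaks of three distinct points; for equal tips the claim follows
    from \<open>K \<ge> 1\<close>.\<close>
  proof (cases "i = j")
    case True
    then show ?thesis using K mult_right_mono[of 1 K "mdist Y (y 0) (y j)"] by simp
  next
    case False
    then show ?thesis
      unfolding y_def using that by (intro bound x ne0 ne arms_le) auto
  qed
  \<comment> \<open>Two comparisons are chained, each costing a factor \<open>K\<close>: from the
    first arm to arm \<open>i\<close> around the centre, then from arm \<open>i\<close> to the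
    distance of tips \<open>i\<close> and \<open>j\<close> around tip \<open>i\<close>.\<close>
  have sep: "D \<le> K ^ 2 * mdist Y (y i) (y j)" if ij: "i \<in> {1..n}" "j \<in> {1..n}" "i \<noteq> j" for i j
  proof -
    have "mdist X (x i) (x 0) \<le> 2 * mdist X (x i) (x j)"
      using long[OF ij] arms(2)[OF ij(1)] mdist_commute[of X "x i" "x 0"]
        mdist_nonneg[of X "x i" "x j"] by linarith
    then have *: "mdist Y (y i) (y 0) \<le> K * mdist Y (y i) (y j)"
      unfolding y_def using ij by (intro bound x ne ne0 ne0[symmetric]) auto
    have "D \<le> K * mdist Y (y 0) (y i)"
      unfolding D_def using ij \<open>n \<ge> 1\<close> by (intro arm_compare) auto
    also have "\<dots> \<le> K * (K * mdist Y (y i) (y j))"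
      using * K by (intro mult_left_mono) (simp_all add: mdist_commute)
    finally show ?thesis by (simp add: power2_eq_square mult.assoc)
  qed
  \<comment> \<open>Two powers of \<open>K\<close> come from \<open>sep\<close>, the third from the
    radius \<open>K * D\<close>; the factor 2 makes the inequality strict.\<close>
  have sep': "1 / (2 * K ^ 3) * (K * D) < mdist Y (y i) (y j)"
    if ij: "i \<in> {1..n}" "j \<in> {1..n}" "i \<noteq> j" for i j
  proof -
    have "1 / (2 * K ^ 3) * (K * D) = D / 2 / K ^ 2"
      using K by (simp add: power3_eq_cube power2_eq_square)
    also have "\<dots> < D / K ^ 2"
      using K \<open>D > 0\<close> by (intro divide_strict_right_mono) auto
    also have "\<dots> \<le> mdist Y (y i) (y j)"
      using sep[OF ij] K by (simp add: divide_le_eq mult.commute)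
    finally show ?thesis .
  qed
  have "inj_on y {1..n}"
    using ne x inj unfolding y_def by (intro inj_onI) (metis atLeastAtMost_iff inj_onD)
  then have "card (y ` {1..n}) = n"
    by (simp add: card_image)
  moreover have "y ` {1..n} \<subseteq> mcball_of Y (y 0) (K * D)"
    using y arm_compare[of _ 1] \<open>n \<ge> 1\<close> by (auto simp: D_def)
  moreover have "pairwise (\<lambda>p q. 1 / (2 * K ^ 3) * (K * D) < mdist Y p q) (y ` {1..n})"
    using sep' unfolding pairwise_def by blast
  moreover have "0 < K * D" "y 0 \<in> mspace Y"
    using K \<open>D > 0\<close> y by simp_all
  ultimately show ?thesis
    by (intro bexI[of _ "y 0"] exI[of _ "K * D"] exI[of _ "y ` {1..n}"] conjI)
qed

theorem theorem2p4:
  fixes X :: "'a metric" and Y :: "'b metric" and \<phi> :: "'a \<Rightarrow> 'b"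
  assumes "starry X"
    and "quasisymmetric X Y \<phi>"
  shows "assouad_dim Y = \<infinity>"
proof -
  obtain \<Psi> where hom: "homeomorphic_map (mtopology_of X) (mtopology_of Y) \<phi>"
    and mono: "mono_on {0<..} \<Psi>"
    and qs: "\<forall>x\<in>mspace X. \<forall>y\<in>mspace X. \<forall>z\<in>mspace X. x \<noteq> y \<and> x \<noteq> z \<and> y \<noteq> z \<longrightarrow>
        mdist Y (\<phi> x) (\<phi> y) / mdist Y (\<phi> x) (\<phi> z) \<le> \<Psi> (mdist X x y / mdist X x z)"
    using assms(2) unfolding quasisymmetric_def by (elim exE conjE)
  have maps: "\<phi> \<in> mspace X \<rightarrow> mspace Y" and inj: "inj_on \<phi> (mspace X)"
    using homeomorphic_imp_surjective_map[OF hom] homeomorphic_imp_injective_map[OF hom] by auto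
  \<comment> \<open>The maximum with 1 ensures that the ratio \<open>1 / (2 * K ^ 3)\<close> lies
    below 1.\<close>
  define K where "K = max 1 (\<Psi> 2)"
  have K: "K \<ge> 1" "\<Psi> 2 \<le> K"
    by (simp_all add: K_def)
  have "1 \<le> K ^ 3"
    using K by (intro one_le_power)
  then have "1 < 2 * K ^ 3"
    by linarith
  with K(1) have c: "0 < 1 / (2 * K ^ 3)" "1 / (2 * K ^ 3) < 1"
    by (simp_all add: divide_less_eq)
  show ?thesis
  proof (rule assouad_dim_eq_infinity[OF c])
    fix n
    show "\<exists>a\<in>mspace Y. \<exists>R>0. \<exists>S \<subseteq> mcball_of Y a R.
            card S = n \<and> pairwise (\<lambda>p q. 1 / (2 * K ^ 3) * R < mdist Y p q) S"
    \<comment> \<open>Without tips there is no reference arm. For \<open>n = 0\<close> the empty set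
      serves as \<open>S\<close>, and the image of the centre of a star supplies the required point
      of \<open>Y\<close>.\<close>
    proof (cases "n = 0")
      case True
      obtain A \<eta> where "approximate_star X A \<eta> 0"
        using assms(1) unfolding starry_def by blast
      then obtain a where "a \<in> mspace X"
        unfolding approximate_star_def by auto
      then have "\<phi> a \<in> mspace Y"
        using maps by auto
      moreover have "(0::real) < 1" "{} \<subseteq> mcball_of Y (\<phi> a) 1"
        "card ({} :: 'b set) = n" "pairwise (\<lambda>p q. 1 / (2 * K ^ 3) * 1 < mdist Y p q) {}"
        using True by simp_all
      ultimately show ?thesis
        by (intro bexI[of _ "\<phi> a"] exI[of _ "1::real"] exI[of _ "{}"] conjI)
    next
      case False
      obtain A \<eta> where "approximate_star X A \<eta> n"
        using assms(1) unfolding starry_def by blast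
      then show ?thesis
        using False by (intro quasisymmetric_image_of_star[OF _ _ maps inj mono _ K]) (simp_all add: qs)
    qed
  qed
qed

end
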